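(* Let $\pi = 1 \oplus \rho$ where $\rho$ ends with its smallest entry and its first entry $\rho(1)$ satisfies $\rho(1)\neq 2$ and $\rho(1)\neq|\rho|$; equivalently, $\pi$ has the form $1\,z\cdots 2$ with $z \neq 3$ and $z \neq |\pi|$. Then the class $\operatorname{Av}(\pi)$ is not deflatable.
   Context: A permutation $\alpha$ is contained in $\beta$ if $\beta$ has a subsequence in the same relative order as $\alpha$; a class is a set of permutations closed under taking contained permutations; $\operatorname{Av}(\pi)$ is the class of permutations not containing $\pi$. $1\oplus\rho$ denotes a new minimum entry placed before a copy of $\rho$. An interval of a permutation is a set of entries whose positions and values each form a set of consecutive integers, the whole permutation not counting as an interval; a permutation is simple if all its intervals are single entries (so $1$, $12$, $21$ are simple). A class $\mathcal{C}$ is deflatable if there is a proper subclass $\mathcal{D}\subsetneq\mathcal{C}$ with $\mathcal{C}\subseteq\langle\mathcal{D}\rangle$, where the substitution closure $\langle\mathcal{D}\rangle$ is the largest class whose simple permutations are exactly those of $\mathcal{D}$; equivalently, $\mathcal{C}$ is not deflatable if and only if every permutation in $\mathcal{C}$ is contained in some simple permutation belonging to $\mathcal{C}$. *)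

theory Defs
  imports Main "HOL-Library.Sublist"
begin

text \<open>
  Permutations are nonempty and written in one-line notation: the entry in position i
  (counted from 0) of a permutation of length n is a value in 1, ..., n.
\<close>

definition perm :: "nat list \<Rightarrow> bool" where
  "perm \<sigma> \<longleftrightarrow> \<sigma> \<noteq> [] \<and> distinct \<sigma> \<and> set \<sigma> = {1..length \<sigma>}"

definition same_order :: "nat list \<Rightarrow> nat list \<Rightarrow> bool" where
  "same_order xs ys \<longleftrightarrow> length xs = length ys \<and>
     (\<forall>i<length xs. \<forall>j<length xs. xs ! i < xs ! j \<longleftrightarrow> ys ! i < ys ! j)"

definition contained_in :: "nat list \<Rightarrow> nat list \<Rightarrow> bool" where
  "contained_in \<alpha> \<beta> \<longleftrightarrow> (\<exists>xs. subseq xs \<beta> \<and> same_order xs \<alpha>)"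

definition perm_class :: "nat list set \<Rightarrow> bool" where
  "perm_class C \<longleftrightarrow> (\<forall>\<beta>\<in>C. perm \<beta>) \<and>
     (\<forall>\<alpha> \<beta>. \<beta> \<in> C \<longrightarrow> perm \<alpha> \<longrightarrow> contained_in \<alpha> \<beta> \<longrightarrow> \<alpha> \<in> C)"

definition Av :: "nat list \<Rightarrow> nat list set" where
  "Av \<pi> = {\<sigma>. perm \<sigma> \<and> \<not> contained_in \<pi> \<sigma>}"

definition one_oplus :: "nat list \<Rightarrow> nat list" where
  "one_oplus \<rho> = 1 # map Suc \<rho>"

text \<open>
  A set of entries is given by its set S of values, which determines the positions since
  the entries are distinct. Intervals are nonempty and proper, so that \<open>[1]\<close> has none.
\<close>

definition interval_of :: "nat list \<Rightarrow> nat set \<Rightarrow> bool" where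
  "interval_of \<sigma> S \<longleftrightarrow> S \<noteq> {} \<and> S \<subset> set \<sigma> \<and>
     (\<exists>a b. S = {a..b}) \<and>
     (\<exists>i j. {k. k < length \<sigma> \<and> \<sigma> ! k \<in> S} = {i..j})"

definition simple_perm :: "nat list \<Rightarrow> bool" where
  "simple_perm \<sigma> \<longleftrightarrow> perm \<sigma> \<and> (\<forall>S. interval_of \<sigma> S \<longrightarrow> is_singleton S)"

definition simples :: "nat list set \<Rightarrow> nat list set" where
  "simples C = {\<sigma> \<in> C. simple_perm \<sigma>}"

definition subst_closure :: "nat list set \<Rightarrow> nat list set" where
  "subst_closure D = (GREATEST E. perm_class E \<and> simples E = simples D)"

text \<open>The largest class exists, namely the union of all classes with the same simples.\<close>

lemma subst_closure_eq_Union: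
  assumes "perm_class D"
  shows "subst_closure D = \<Union>{E. perm_class E \<and> simples E = simples D}"
  unfolding subst_closure_def
proof (rule Greatest_equality)
  let ?U = "\<Union>{E. perm_class E \<and> simples E = simples D}"
  have "perm_class ?U"
    unfolding perm_class_def by blast
  moreover have "simples ?U = simples D"
    using assms unfolding simples_def by blast
  ultimately show "perm_class ?U \<and> simples ?U = simples D" ..
qed blast

definition deflatable :: "nat list set \<Rightarrow> bool" where
  "deflatable C \<longleftrightarrow> (\<exists>D. perm_class D \<and> D \<subset> C \<and> C \<subseteq> subst_closure D)"

end

theory Submission imports Defs Complex_Main
begin

text \<open>
  Permutations are viewed as finite point sets in the plane, up to order isomorphism. It suffices
  to embed every permutation avoiding \<open>\<pi> = 1 z \<dots> 2\<close> in a simple one avoiding \<open>\<pi>\<close>. First inflate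
  \<open>2413\<close> at its entry \<open>1\<close>, which gives a point set that is neither a direct sum nor a skew sum, so
  that a maximal proper block \<open>I\<close> overlaps no other proper block. A new point \<open>p\<close> that cuts \<open>I\<close> in
  one coordinate and is separated from \<open>I\<close> by another point in the other coordinate destroys \<open>I\<close>
  without creating a new nontrivial block, so the number of nontrivial blocks drops.

  Such a \<open>p\<close> can be placed without creating \<open>\<pi>\<close>. If some point lies southwest of \<open>I\<close>, let \<open>c\<close> be
  the leftmost point below \<open>I\<close> and put \<open>p\<close> just left of \<open>c\<close> and just below the top of \<open>I\<close>: then \<open>p\<close>
  could only play the \<open>1\<close>, and \<open>c\<close> could replace it. Otherwise let \<open>e\<close> be the lowest point above
  \<open>I\<close>. If \<open>e\<close> is to the right of \<open>I\<close> or immediately to its left, put \<open>p\<close> just above \<open>e\<close> and just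
  right of the leftmost point of \<open>I\<close>; here \<open>z \<noteq> 3\<close> and \<open>z \<noteq> |\<pi>|\<close> are used. In the remaining case
  put \<open>p\<close> just below the top of \<open>I\<close> and just left of the rightmost point to the left of \<open>I\<close>: then
  \<open>p\<close> could only play the \<open>1\<close>, and, again since \<open>z \<noteq> |\<pi>|\<close>, \<open>e\<close> could replace it.
\<close>

section \<open>Point sets, pattern occurrences and blocks\<close>

definition generic :: "(real \<times> real) set \<Rightarrow> bool" where
  "generic S \<longleftrightarrow> finite S \<and> inj_on fst S \<and> inj_on snd S"

definition occurs :: "(real \<times> real) set \<Rightarrow> nat list \<Rightarrow> (nat \<Rightarrow> real \<times> real) \<Rightarrow> bool" where
  "occurs S \<alpha> g \<longleftrightarrow> (\<forall>i<length \<alpha>. g i \<in> S) \<and>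
     (\<forall>j<length \<alpha>. \<forall>i<j. fst (g i) < fst (g j)) \<and>
     (\<forall>i<length \<alpha>. \<forall>j<length \<alpha>. \<alpha> ! i < \<alpha> ! j \<longleftrightarrow> snd (g i) < snd (g j))"

text \<open>One direction suffices: when \<open>f\<close> is injective on \<open>S\<close>, the
  contrapositive gives the mirror statement, so each outside point lies entirely on one side of
  \<open>K\<close>.\<close>

definition convex_in :: "('a \<Rightarrow> real) \<Rightarrow> 'a set \<Rightarrow> 'a set \<Rightarrow> bool" where
  "convex_in f S K \<longleftrightarrow> (\<forall>p\<in>S - K. \<forall>q\<in>K. \<forall>r\<in>K. f q < f p \<longrightarrow> f r < f p)"

definition block :: "(real \<times> real) set \<Rightarrow> (real \<times> real) set \<Rightarrow> bool" where
  "block S K \<longleftrightarrow> K \<subseteq> S \<and> convex_in fst S K \<and> convex_in snd S K"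

definition nontrivial_blocks :: "(real \<times> real) set \<Rightarrow> (real \<times> real) set set" where
  "nontrivial_blocks S = {K. block S K \<and> K \<noteq> S \<and> 2 \<le> card K}"

text \<open>Excludes exactly the direct sums and skew sums of two nonempty point sets.\<close>

definition indecomposable :: "(real \<times> real) set \<Rightarrow> bool" where
  "indecomposable S \<longleftrightarrow> (\<forall>K L. block S K \<longrightarrow> block S L \<longrightarrow> K \<noteq> S \<longrightarrow> L \<noteq> S \<longrightarrow> K \<union> L \<noteq> S)"

text \<open>The two coordinates have different roles. In \<open>g\<close> the point \<open>p\<close>
  falls strictly inside the range of \<open>I\<close>, so \<open>I\<close> alone stops being a
  block; in \<open>f\<close> the point \<open>s\<close> separates \<open>p\<close> from
  \<open>I\<close>, so adjoining \<open>p\<close> does not restore it.\<close>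

definition cuts :: "('a \<Rightarrow> real) \<Rightarrow> ('a \<Rightarrow> real) \<Rightarrow> 'a set \<Rightarrow> 'a set \<Rightarrow> 'a \<Rightarrow> bool" where
  "cuts f g S I p \<longleftrightarrow> (\<exists>q\<in>I. \<exists>r\<in>I. g q < g p \<and> g p < g r) \<and>
     (\<exists>s\<in>S - I. (\<forall>q\<in>I. f q < f s) \<and> f s < f p \<or> (\<forall>q\<in>I. f s < f q) \<and> f p < f s)"

lemma cutsI:
  assumes "q \<in> I" "r \<in> I" "g q < g p" "g p < g r" "s \<in> S" "s \<notin> I"
    and "(\<forall>q\<in>I. f q < f s) \<and> f s < f p \<or> (\<forall>q\<in>I. f s < f q) \<and> f p < f s"
  shows "cuts f g S I p"
  using assms unfolding cuts_def by blast

lemma genericD: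
  assumes "generic S"
  shows "finite S" "\<And>p q. p \<in> S \<Longrightarrow> q \<in> S \<Longrightarrow> fst p = fst q \<Longrightarrow> p = q"
    "\<And>p q. p \<in> S \<Longrightarrow> q \<in> S \<Longrightarrow> snd p = snd q \<Longrightarrow> p = q"
  using assms unfolding generic_def inj_on_def by auto

lemma generic_insert:
  assumes "generic S" "fst p \<notin> fst ` S" "snd p \<notin> snd ` S"
  shows "generic (insert p S)"
  using assms unfolding generic_def by auto

lemma convex_inD:
  assumes "convex_in f S K" "p \<in> S" "p \<notin> K" "q \<in> K" "r \<in> K" "f q < f p"
  shows "f r < f p"
  using assms unfolding convex_in_def by blast

lemma blockD:
  assumes "block S K"
  shows "K \<subseteq> S" "convex_in fst S K" "convex_in snd S K"
  using assms unfolding block_def by auto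

lemma finite_nontrivial_blocks:
  "finite S \<Longrightarrow> finite (nontrivial_blocks S)"
  by (rule finite_subset[of _ "Pow S"]) (auto simp: nontrivial_blocks_def block_def)

lemma block_diff_point:
  assumes "block (insert p S) K" "p \<notin> S"
  shows "block S (K - {p})"
  using assms unfolding block_def convex_in_def by (intro conjI) (blast+)

lemma block_singleton: "x \<in> S \<Longrightarrow> block S {x}"
  unfolding block_def convex_in_def by auto

lemma block_self: "block S S"
  unfolding block_def convex_in_def by auto

text \<open>A common point \<open>t\<close> carries the comparison with \<open>p\<close> from one
  set to the other.\<close>

lemma convex_in_union:
  assumes "convex_in f S K" "convex_in f S L" "K \<inter> L \<noteq> {}"
  shows "convex_in f S (K \<union> L)"
  unfolding convex_in_def
proof (intro ballI impI)
  fix p q r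
  assume h: "p \<in> S - (K \<union> L)" "q \<in> K \<union> L" "r \<in> K \<union> L" "f q < f p"
  obtain t where t: "t \<in> K" "t \<in> L" using assms(3) by blast
  have "f t < f p"
    using h t convex_inD[OF assms(1), of p q t] convex_inD[OF assms(2), of p q t] by blast
  then show "f r < f p"
    using h t convex_inD[OF assms(1), of p t r] convex_inD[OF assms(2), of p t r] by blast
qed

lemma block_union:
  "block S K \<Longrightarrow> block S L \<Longrightarrow> K \<inter> L \<noteq> {} \<Longrightarrow> block S (K \<union> L)"
  unfolding block_def by (simp add: convex_in_union)

section \<open>One-point extensions that destroy a maximal block\<close>

text \<open>Otherwise \<open>p\<close> would be a twin of \<open>K\<close>. If \<open>K = S\<close>,
  then \<open>p\<close> lies inside the range of \<open>K\<close> in \<open>g\<close>. If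
  \<open>K\<close> misses \<open>I\<close>, then a member of \<open>K\<close> would sit together
  with \<open>p\<close> between two points of \<open>I\<close> in \<open>g\<close>, against the
  convexity of \<open>I\<close>. If \<open>K\<close> is inside \<open>I\<close>, the point
  \<open>s\<close> separates \<open>p\<close> from \<open>K\<close> in \<open>f\<close>.\<close>

lemma cuts_not_both_convex:
  assumes cut: "cuts f g S I p"
    and p: "p \<notin> S" "f p \<notin> f ` S" "g p \<notin> g ` S" and inj: "inj_on g S"
    and I: "I \<subseteq> S" "convex_in g S I"
    and K: "K \<subseteq> S" "K \<noteq> {}" "K = S \<or> (K \<inter> I \<noteq> {} \<longrightarrow> K \<subseteq> I)"
    and c1: "convex_in g (insert p S) K"
    and c2: "convex_in f (insert p S) (insert p K)" "convex_in g (insert p S) (insert p K)"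
  shows False
proof -
  obtain q r where qr: "q \<in> I" "r \<in> I" "g q < g p" "g p < g r"
    using cut unfolding cuts_def by blast
  obtain s where s: "s \<in> S" "s \<notin> I"
      "(\<forall>q\<in>I. f q < f s) \<and> f s < f p \<or> (\<forall>q\<in>I. f s < f q) \<and> f p < f s"
    using cut unfolding cuts_def by blast
  show False
  proof (cases "K = S")
    case True
    then show False using convex_inD[OF c1, of p q r] qr I p by auto
  next
    case False
    show False
    proof (cases "K \<inter> I = {}")
      case True
      obtain k where k: "k \<in> K" using K(2) by blast
      have n: "q \<notin> insert p K" "r \<notin> insert p K" "k \<notin> I" using True qr k p I by auto
      have "\<not> g k < g q"
        using convex_inD[OF c2(2), of q k p] n qr k I by auto
      moreover have "g k \<noteq> g q" using inj_onD[OF inj, of k q] n qr k I K by auto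
      ultimately have a: "g q < g k" by simp
      have b: "g k < g r"
        using convex_inD[OF c2(2), of r p k] n qr k I by auto
      show False using convex_inD[OF I(2), of k q r] a b n k K qr by auto
    next
      case F: False
      then have KI: "K \<subseteq> I" using K(3) False by blast
      obtain k where k: "k \<in> K" using K(2) by blast
      have sn: "s \<notin> insert p K" using s KI p by auto
      show False
        using convex_inD[OF c2(1), of s k p] convex_inD[OF c2(1), of s p k] s sn k KI by force
    qed
  qed
qed

locale block_extension =
  fixes S I :: "(real \<times> real) set" and p :: "real \<times> real"
  assumes gen: "generic S" and indec: "indecomposable S"
    and I: "I \<in> nontrivial_blocks S"
    and I_max: "\<And>K. block S K \<Longrightarrow> K \<noteq> S \<Longrightarrow> K \<inter> I \<noteq> {} \<Longrightarrow> K \<subseteq> I"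
    and fresh: "fst p \<notin> fst ` S" "snd p \<notin> snd ` S"
    and cut: "cuts fst snd S I p \<or> cuts snd fst S I p"
begin

lemma I_block: "block S I" "I \<noteq> S" "2 \<le> card I"
  using I unfolding nontrivial_blocks_def by auto

lemma p_notin: "p \<notin> S"
  using fresh by auto

lemma not_both_blocks:
  assumes "block (insert p S) K" "block (insert p S) (insert p K)" "K \<subseteq> S" "K \<noteq> {}"
  shows False
proof -
  have "block S K" using block_diff_point[OF assms(1) p_notin] assms(3) p_notin
    by (metis Diff_empty Diff_insert0 subsetD)
  then have *: "K = S \<or> (K \<inter> I \<noteq> {} \<longrightarrow> K \<subseteq> I)" using I_max by blast
  show False
    using cut cuts_not_both_convex[OF _ p_notin fresh _ _ _ assms(3,4) *]
      cuts_not_both_convex[OF _ p_notin fresh(2,1) _ _ _ assms(3,4) *]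
      blockD[OF I_block(1)] blockD[OF assms(1)] blockD[OF assms(2)] gen
    unfolding generic_def by blast
qed

lemma I_not_block: "\<not> block (insert p S) (insert p I)" "\<not> block (insert p S) I"
proof -
  have key: False if c: "cuts f g S I p"
    and "convex_in f (insert p S) (insert p I) \<or> convex_in g (insert p S) I" for f g
  proof -
    obtain q r where qr: "q \<in> I" "r \<in> I" "g q < g p" "g p < g r"
      using c unfolding cuts_def by blast
    obtain s where s: "s \<in> S" "s \<notin> I"
      "(\<forall>q\<in>I. f q < f s) \<and> f s < f p \<or> (\<forall>q\<in>I. f s < f q) \<and> f p < f s"
      using c unfolding cuts_def by blast
    have pI: "p \<notin> I" using p_notin blockD(1)[OF I_block(1)] by auto
    have sp: "s \<notin> insert p I" using s p_notin by auto
    from that(2) show False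
    proof
      assume c2: "convex_in f (insert p S) (insert p I)"
      show False
        using convex_inD[OF c2, of s q p] convex_inD[OF c2, of s p q] s sp qr by force
    next
      assume c1: "convex_in g (insert p S) I"
      show False
        using convex_inD[OF c1, of p q r] qr pI by force
    qed
  qed
  show "\<not> block (insert p S) (insert p I)" "\<not> block (insert p S) I"
    using key cut blockD by blast+
qed

text \<open>Deleting \<open>p\<close> maps the nontrivial blocks of \<open>insert p S\<close>
  injectively to nontrivial blocks of \<open>S\<close>. The block \<open>I\<close> is never hit:
  only \<open>I\<close> and \<open>insert p I\<close> could map to it, and neither is a block any
  more.\<close>

lemma card_nontrivial_blocks_less:
  "card (nontrivial_blocks (insert p S)) < card (nontrivial_blocks S)"
proof -
  let ?N = "nontrivial_blocks (insert p S)"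
  let ?h = "\<lambda>K. K - {p}"
  have fin: "finite (nontrivial_blocks S)"
    using finite_nontrivial_blocks genericD(1)[OF gen] .
  have Ne: "S \<noteq> {}" using I_block blockD(1) by fastforce
  have h: "?h J \<in> nontrivial_blocks S - {I}" if J: "J \<in> ?N" for J
  proof -
    have Jb: "block (insert p S) J" "J \<noteq> insert p S" "2 \<le> card J"
      using J unfolding nontrivial_blocks_def by auto
    have b: "block S (?h J)" using block_diff_point[OF Jb(1) p_notin] .
    \<comment> \<open>Here \<open>J\<close> would be \<open>S\<close>, but \<open>S\<close> and
      \<open>insert p S\<close> cannot both be blocks.\<close>
    have nS: "?h J \<noteq> S"
    proof
      assume e: "?h J = S"
      then have "J = S" using Jb(2) by auto
      then show False using not_both_blocks[of S] Jb block_self Ne by auto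
    qed
    have cJ: "2 \<le> card (?h J)"
    proof (cases "p \<in> J")
      case True
      \<comment> \<open>Otherwise \<open>J\<close> consists of \<open>p\<close> and one point
        \<open>x\<close>, and both \<open>{x}\<close> and \<open>{x, p}\<close> are blocks.\<close>
      have "card (?h J) \<noteq> 1"
      proof
        assume "card (?h J) = 1"
        then obtain x where x: "?h J = {x}" by (auto simp: card_1_singleton_iff)
        then have "J = insert p {x}" "x \<in> S" using True b blockD(1) by auto
        then show False using not_both_blocks[of "{x}"] Jb block_singleton by auto
      qed
      then show ?thesis using Jb True by (simp add: card_Diff_singleton)
    qed (use Jb in simp)
    have "?h J \<noteq> I" using I_not_block Jb(1) by (metis Diff_empty Diff_insert0 insert_Diff)
    then show ?thesis using b nS cJ unfolding nontrivial_blocks_def by auto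
  qed
  have "inj_on ?h ?N"
  proof (rule inj_onI, rule ccontr)
    fix J L assume J: "J \<in> ?N" "L \<in> ?N" "?h J = ?h L" "J \<noteq> L"
    let ?K = "?h J"
    have "?K \<in> nontrivial_blocks S" using h J by blast
    then have "block S ?K" "2 \<le> card ?K" unfolding nontrivial_blocks_def by blast+
    then have K: "?K \<subseteq> S" "?K \<noteq> {}" using blockD(1) by (blast, fastforce)
    \<comment> \<open>Two preimages of the same block differ exactly in \<open>p\<close>, which
      \<open>not_both_blocks\<close> excludes.\<close>
    have "(J = ?K \<and> L = insert p ?K) \<or> (L = ?K \<and> J = insert p ?K)" using J by blast
    moreover have "block (insert p S) J" "block (insert p S) L"
      using J unfolding nontrivial_blocks_def by blast+
    ultimately show False using not_both_blocks[OF _ _ K] by metis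
  qed
  then have "card ?N = card (?h ` ?N)" by (simp add: card_image)
  also have "\<dots> \<le> card (nontrivial_blocks S - {I})"
    by (rule card_mono) (use fin h in auto)
  also have "\<dots> < card (nontrivial_blocks S)" using fin I by (rule card_Diff1_less)
  finally show ?thesis .
qed

text \<open>Deleting \<open>p\<close> from two proper blocks that cover \<open>insert p S\<close>
  would leave two proper blocks that cover \<open>S\<close>.\<close>

lemma indecomposable_insert: "indecomposable (insert p S)"
  unfolding indecomposable_def
proof (intro allI impI notI)
  fix K L
  assume b: "block (insert p S) K" "block (insert p S) L"
    and n: "K \<noteq> insert p S" "L \<noteq> insert p S" and u: "K \<union> L = insert p S"
  have Ne: "S \<noteq> {}" using I_block blockD(1) by fastforce
  have nS: "J - {p} \<noteq> S" if "block (insert p S) J" "J \<noteq> insert p S" for J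
  proof
    assume "J - {p} = S"
    then have "J = S" using that by auto
    then show False using not_both_blocks[of S] that block_self Ne by auto
  qed
  have "(K - {p}) \<union> (L - {p}) = S" using u p_notin by auto
  then show False
    using indec block_diff_point[OF b(1) p_notin] block_diff_point[OF b(2) p_notin]
      nS[OF b(1) n(1)] nS[OF b(2) n(2)] unfolding indecomposable_def by blast
qed

end

section \<open>Coordinates next to a given one\<close>

text \<open>Makes placements such as "just left of" precise: \<open>x\<close> and \<open>c\<close>
  compare in the same way with every element of \<open>A\<close> other than
  \<open>c\<close>.\<close>

lemma just_below:
  fixes c :: real
  assumes "finite A"
  obtains x where "x < c" "x \<notin> A" "\<And>a. a \<in> A \<Longrightarrow> a < c \<Longrightarrow> a < x"
proof (cases "{a \<in> A. a < c} = {}")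
  case True
  then show ?thesis using that[of "c - 1"] by force
next
  case False
  let ?m = "Max {a \<in> A. a < c}"
  have fin: "finite {a \<in> A. a < c}" using assms by simp
  have "?m < c" using Max_in[OF fin False] by simp
  then obtain x where x: "?m < x" "x < c" using dense by blast
  have "a < x" if "a \<in> A" "a < c" for a
    using Max_ge[OF fin, of a] that x by auto
  then show ?thesis using that[of x] x by force
qed

lemma just_above:
  fixes c :: real
  assumes "finite A"
  obtains x where "c < x" "x \<notin> A" "\<And>a. a \<in> A \<Longrightarrow> c < a \<Longrightarrow> x < a"
proof -
  obtain y where y: "y < - c" "y \<notin> uminus ` A" "\<And>a. a \<in> uminus ` A \<Longrightarrow> a < - c \<Longrightarrow> a < y"
    using just_below[of "uminus ` A" "- c"] assms by blast
  show ?thesis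
  proof (rule that[of "- y"])
    show "c < - y" using y(1) by simp
    show "- y \<notin> A" using y(2) by force
    show "- y < a" if "a \<in> A" "c < a" for a using y(3)[of "- a"] that by auto
  qed
qed

lemma ex_min:
  fixes f :: "'a \<Rightarrow> real"
  assumes "finite A" "A \<noteq> {}"
  shows "\<exists>a\<in>A. \<forall>b\<in>A. f a \<le> f b"
  using arg_min_if_finite(1)[OF assms] arg_min_least[OF assms] by blast

lemma ex_max:
  fixes f :: "'a \<Rightarrow> real"
  assumes "finite A" "A \<noteq> {}"
  shows "\<exists>a\<in>A. \<forall>b\<in>A. f b \<le> f a"
  using ex_min[OF assms, of "\<lambda>x. - f x"] by simp

section \<open>Occurrences of the pattern\<close>

text \<open>
  The pattern \<open>1 z \<dots> 2\<close> of the theorem: \<open>k\<close> is the index of an entry strictly between \<open>2\<close>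
  and \<open>z\<close> in value, \<open>m\<close> that of an entry above \<open>z\<close>.
\<close>

locale pattern =
  fixes \<pi> :: "nat list" and k m :: nat
  assumes first_min: "\<And>i. 0 < i \<Longrightarrow> i < length \<pi> \<Longrightarrow> \<pi> ! 0 < \<pi> ! i"
    and last_min: "\<And>i. 0 < i \<Longrightarrow> i < length \<pi> - 1 \<Longrightarrow> \<pi> ! (length \<pi> - 1) < \<pi> ! i"
    and k: "1 < k" "k < length \<pi> - 1" "\<pi> ! k < \<pi> ! 1"
    and m: "1 < m" "m < length \<pi> - 1" "\<pi> ! 1 < \<pi> ! m"
begin

abbreviation "last_index \<equiv> length \<pi> - 1"

lemma occursD:
  assumes "occurs S \<pi> g"
  shows "\<And>i. i < length \<pi> \<Longrightarrow> g i \<in> S"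
    and "\<And>i j. i < j \<Longrightarrow> j < length \<pi> \<Longrightarrow> fst (g i) < fst (g j)"
    and "\<And>i. 0 < i \<Longrightarrow> i < length \<pi> \<Longrightarrow> snd (g 0) < snd (g i)"
    and "\<And>i. 0 < i \<Longrightarrow> i < last_index \<Longrightarrow> snd (g last_index) < snd (g i)"
    and "snd (g k) < snd (g 1)" "snd (g 1) < snd (g m)"
proof -
  have len: "length \<pi> > 3" using k by simp
  have o: "\<And>i j. i < length \<pi> \<Longrightarrow> j < length \<pi> \<Longrightarrow> \<pi> ! i < \<pi> ! j \<Longrightarrow> snd (g i) < snd (g j)"
    using assms unfolding occurs_def by blast
  show "\<And>i. i < length \<pi> \<Longrightarrow> g i \<in> S" "\<And>i j. i < j \<Longrightarrow> j < length \<pi> \<Longrightarrow> fst (g i) < fst (g j)"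
    using assms unfolding occurs_def by blast+
  show "snd (g 0) < snd (g i)" if "0 < i" "i < length \<pi>" for i
    by (rule o) (use first_min that len in auto)
  show "snd (g last_index) < snd (g i)" if "0 < i" "i < last_index" for i
    by (rule o) (use last_min that len in auto)
  show "snd (g k) < snd (g 1)" "snd (g 1) < snd (g m)"
    by (rule o; use k m in simp)+
qed

text \<open>The first entry of \<open>\<pi>\<close> is also its lowest, so any point southwest of
  the images of all other entries can play it.\<close>

lemma occurs_replace_first:
  assumes "occurs S' \<pi> g" "c \<in> S"
    and "\<And>i. 0 < i \<Longrightarrow> i < length \<pi> \<Longrightarrow> g i \<in> S \<and> fst c < fst (g i) \<and> snd c < snd (g i)"
  shows "occurs S \<pi> (g(0 := c))"
  unfolding occurs_def
proof (intro conjI allI impI)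
  fix i assume "i < length \<pi>"
  then show "(g(0 := c)) i \<in> S" using assms by auto
next
  fix j i assume "j < length \<pi>" "i < j"
  then show "fst ((g(0 := c)) i) < fst ((g(0 := c)) j)"
    using assms(3)[of j] occursD(2)[OF assms(1)] by auto
next
  fix i j assume ij: "i < length \<pi>" "j < length \<pi>"
  consider "i = 0" "j = 0" | "i = 0" "0 < j" | "0 < i" "j = 0" | "0 < i" "0 < j" by auto
  then show "\<pi> ! i < \<pi> ! j \<longleftrightarrow> snd ((g(0 := c)) i) < snd ((g(0 := c)) j)"
  proof cases
    case 2
    then show ?thesis using assms(3)[of j] first_min[of j] ij by auto
  next
    case 3
    then show ?thesis using assms(3)[of i] first_min[of i] ij by auto
  next
    case 4
    then show ?thesis using assms(1) ij unfolding occurs_def by auto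
  qed simp
qed

text \<open>As \<open>S\<close> avoids \<open>\<pi>\<close>, the occurrence must use
  \<open>p\<close>; it does so at one index only, because the images have increasing first
  coordinates.\<close>

lemma occurs_insertE:
  assumes "occurs (insert p S) \<pi> g" "\<nexists>g. occurs S \<pi> g" "p \<notin> S"
  obtains l where "l < length \<pi>" "g l = p" "\<And>i. i < length \<pi> \<Longrightarrow> i \<noteq> l \<Longrightarrow> g i \<in> S"
proof -
  have "\<exists>l<length \<pi>. g l = p"
  proof (rule ccontr)
    assume "\<not> ?thesis"
    then have "occurs S \<pi> g" using assms(1) unfolding occurs_def by auto
    then show False using assms(2) by blast
  qed
  then obtain l where l: "l < length \<pi>" "g l = p" by blast
  have "g i \<in> S" if "i < length \<pi>" "i \<noteq> l" for i
  proof -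
    have "fst (g i) \<noteq> fst (g l)"
      using that l occursD(2)[OF assms(1), of i l] occursD(2)[OF assms(1), of l i]
      by (metis less_irrefl nat_neq_iff)
    then show ?thesis using occursD(1)[OF assms(1) that(1)] l by auto
  qed
  then show ?thesis using that l by blast
qed

end

section \<open>Placing the new point without creating the pattern\<close>

locale extension_step = pattern +
  fixes S I :: "(real \<times> real) set"
  assumes gen: "generic S" and indec: "indecomposable S"
    and avoid: "\<nexists>g. occurs S \<pi> g"
    and I: "block S I" "I \<noteq> S" "2 \<le> card I"
begin

lemmas finS = genericD(1)[OF gen]
lemmas fst_eqD = genericD(2)[OF gen]
lemmas snd_eqD = genericD(3)[OF gen]
lemmas I_sub = blockD(1)[OF I(1)]

lemma finI: "finite I"
  using finS I_sub finite_subset by blast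

lemma obtain_other:
  assumes "a \<in> I" obtains b where "b \<in> I" "b \<noteq> a"
proof -
  have "I \<noteq> {a}" using I(3) by auto
  then show ?thesis using that assms by blast
qed

text \<open>Genericity excludes ties, which turns the one-sided condition in
  \<open>convex_in\<close> into both directions.\<close>

lemma fst_side:
  assumes "q \<in> S" "q \<notin> I" "r \<in> I" "t \<in> I"
  shows "fst q < fst r \<Longrightarrow> fst q < fst t" "fst r < fst q \<Longrightarrow> fst t < fst q"
  using convex_inD[OF blockD(2)[OF I(1)], of q r t] convex_inD[OF blockD(2)[OF I(1)], of q t r]
    assms fst_eqD[of q t] I_sub by force+

lemma snd_side:
  assumes "q \<in> S" "q \<notin> I" "r \<in> I" "t \<in> I"
  shows "snd q < snd r \<Longrightarrow> snd q < snd t" "snd r < snd q \<Longrightarrow> snd t < snd q"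
  using convex_inD[OF blockD(3)[OF I(1)], of q r t] convex_inD[OF blockD(3)[OF I(1)], of q t r]
    assms snd_eqD[of q t] I_sub by force+

definition good_point :: "real \<times> real \<Rightarrow> bool" where
  "good_point p \<longleftrightarrow> fst p \<notin> fst ` S \<and> snd p \<notin> snd ` S \<and>
     (cuts fst snd S I p \<or> cuts snd fst S I p) \<and> (\<nexists>g. occurs (insert p S) \<pi> g)"

lemma top_of_block: "\<exists>v\<in>I. \<forall>q\<in>I. q \<noteq> v \<longrightarrow> snd q < snd v"
proof -
  have "I \<noteq> {}" using I(3) by auto
  then obtain v where v: "v \<in> I" "\<And>q. q \<in> I \<Longrightarrow> snd q \<le> snd v"
    using ex_max[OF finI, of snd] by blast
  have "snd q < snd v" if "q \<in> I" "q \<noteq> v" for q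
    using v(2)[OF that(1)] snd_eqD[of q v] that v(1) I_sub by force
  then show ?thesis using v(1) by blast
qed

lemma good_point_southwest:
  assumes "c0 \<in> S" "c0 \<notin> I" "\<And>q. q \<in> I \<Longrightarrow> fst c0 < fst q \<and> snd c0 < snd q"
  shows "\<exists>p. good_point p"
proof -
  \<comment> \<open>All points below \<open>I\<close> compete here, whatever their horizontal
    position; \<open>c0\<close> ensures that the leftmost of them, \<open>c\<close>, is also to the
    left of \<open>I\<close>.\<close>
  let ?C = "{c \<in> S. \<forall>q\<in>I. snd c < snd q}"
  have "finite ?C" "c0 \<in> ?C" using finS assms by simp_all
  then have "finite ?C" "?C \<noteq> {}" by blast+
  then have "\<exists>c\<in>?C. \<forall>d\<in>?C. fst c \<le> fst d" by (rule ex_min)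
  then obtain c where "c \<in> ?C" and c_min: "\<And>d. d \<in> ?C \<Longrightarrow> fst c \<le> fst d" by blast
  then have c: "c \<in> S" "\<And>q. q \<in> I \<Longrightarrow> snd c < snd q" by auto
  have cI: "c \<notin> I" using c(2) by blast
  have cl: "fst c < fst q" if "q \<in> I" for q
  proof -
    have "fst c \<le> fst c0" using c_min assms by auto
    then show ?thesis using assms(3)[OF that] by simp
  qed
  obtain v where v: "v \<in> I" "\<And>q. q \<in> I \<Longrightarrow> q \<noteq> v \<Longrightarrow> snd q < snd v" using top_of_block by blast
  obtain b where b: "b \<in> I" "b \<noteq> v" by (rule obtain_other[OF v(1)])
  obtain x where x: "x < fst c" "x \<notin> fst ` S" "\<And>a. a \<in> fst ` S \<Longrightarrow> a < fst c \<Longrightarrow> a < x"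
    using just_below[of "fst ` S" "fst c"] finS by blast
  obtain y where y: "y < snd v" "y \<notin> snd ` S" "\<And>a. a \<in> snd ` S \<Longrightarrow> a < snd v \<Longrightarrow> a < y"
    using just_below[of "snd ` S" "snd v"] finS by blast
  define p where "p = (x, y)"
  have pS: "p \<notin> S" using x(2) p_def by force
  have cy: "snd c < y" using y(3) c v by auto
  have "snd b < y" using y(3)[of "snd b"] b v I_sub by blast
  then have "cuts fst snd S I p"
    using cutsI[of b I v snd p c S fst] b v y(1) c(1) cI cl x(1) p_def by simp
  moreover have False if occ: "occurs (insert p S) \<pi> g" for g
  proof -
    obtain l where l: "l < length \<pi>" "g l = p" "\<And>i. i < length \<pi> \<Longrightarrow> i \<noteq> l \<Longrightarrow> g i \<in> S"
      using occurs_insertE[OF occ avoid pS] by blast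
    show False
    proof (cases "l = 0")
      case True
      \<comment> \<open>With \<open>p\<close> as the \<open>1\<close>, the other points lie right of
        \<open>x\<close> and above \<open>y\<close>. No point of \<open>S\<close> is horizontally
        between \<open>x\<close> and \<open>c\<close>, and \<open>c\<close> itself is below
        \<open>y\<close>, so all of them are strictly northeast of \<open>c\<close>, which replaces
        \<open>p\<close>.\<close>
      have "g i \<in> S \<and> fst c < fst (g i) \<and> snd c < snd (g i)" if i: "0 < i" "i < length \<pi>" for i
      proof -
        have gi: "g i \<in> S" using l i True by auto
        have "x < fst (g i)" "y < snd (g i)"
          using occursD(2)[OF occ i] occursD(3)[OF occ i] l(2) True p_def by auto
        then show ?thesis using x(3)[of "fst (g i)"] gi cy fst_eqD[of c "g i"] c(1) by force
      qed
      then show False using occurs_replace_first[OF occ c(1)] avoid by blast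
    next
      case False
      \<comment> \<open>A \<open>1\<close> southwest of \<open>p\<close> is left of \<open>I\<close>
        and below its top, hence below all of \<open>I\<close>: a member of \<open>?C\<close>
        further left than \<open>c\<close>.\<close>
      have "g 0 \<in> S" by (rule l(3)) (use l(1) False in auto)
      then have g0: "g 0 \<in> S" "fst (g 0) < x" "snd (g 0) < y"
        using False occursD(2)[OF occ, of 0 l] occursD(3)[OF occ, of l] l p_def by auto
      have "g 0 \<notin> I" using g0 cl[of "g 0"] x(1) by force
      then have "g 0 \<in> ?C" using snd_side(1)[of "g 0" v] g0 y(1) v(1) by force
      then show False using c_min[of "g 0"] g0(2) x(1) by linarith
    qed
  qed
  ultimately have "good_point p" unfolding good_point_def using x y p_def by auto
  then show ?thesis ..
qed

text \<open>With nothing southwest of \<open>I\<close>, every outside point that is not above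
  \<open>I\<close> lies southeast of it. If no point were above, \<open>I\<close> and
  \<open>S - I\<close> would form a skew sum, against indecomposability; so a lowest point above
  \<open>I\<close> can be chosen.\<close>

lemma lowest_above:
  assumes "\<And>c. c \<in> S \<Longrightarrow> c \<notin> I \<Longrightarrow> \<not> (\<forall>q\<in>I. fst c < fst q \<and> snd c < snd q)"
  obtains e where "e \<in> S" "e \<notin> I" "\<And>q. q \<in> I \<Longrightarrow> snd q < snd e"
    "\<And>q r. q \<in> S \<Longrightarrow> q \<notin> I \<Longrightarrow> r \<in> I \<Longrightarrow> snd q < snd e \<Longrightarrow> fst r < fst q \<and> snd q < snd r"
proof -
  let ?E = "{e \<in> S - I. \<forall>q\<in>I. snd q < snd e}"
  have "I \<noteq> {}" using I(3) by auto
  then obtain a where a: "a \<in> I" by blast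
  have se: "fst r < fst q \<and> snd q < snd r" if "q \<in> S" "q \<notin> I" "q \<notin> ?E" "r \<in> I" for q r
  proof -
    have "\<not> snd r < snd q" using that snd_side(2)[of q r] by auto
    then have 1: "snd q < snd r" using that snd_eqD[of q r] I_sub by force
    have "\<not> fst q < fst r"
    proof
      assume "fst q < fst r"
      then have "\<forall>t\<in>I. fst q < fst t \<and> snd q < snd t"
        using 1 that fst_side(1)[of q r] snd_side(1)[of q r] by blast
      then show False using assms[of q] that by blast
    qed
    then show ?thesis using 1 that fst_eqD[of q r] I_sub by force
  qed
  have "?E \<noteq> {}"
  proof
    assume E: "?E = {}"
    have "block S (S - I)"
      unfolding block_def convex_in_def
    proof (intro conjI ballI impI)
      fix p q r assume h: "p \<in> S - (S - I)" "q \<in> S - I" "r \<in> S - I"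
      then have "fst p < fst q" "snd r < snd p" using se[of q p] se[of r p] E by blast+
      then show "fst q < fst p \<Longrightarrow> fst r < fst p" "snd q < snd p \<Longrightarrow> snd r < snd p" by simp_all
    qed blast
    moreover have "S - I \<noteq> S" "I \<union> (S - I) = S" using a I_sub by auto
    ultimately show False using indec I unfolding indecomposable_def by blast
  qed
  moreover have "finite ?E" using finS by simp
  ultimately have "\<exists>e\<in>?E. \<forall>d\<in>?E. snd e \<le> snd d" by (rule ex_min[rotated])
  then obtain e where e: "e \<in> ?E" "\<And>d. d \<in> ?E \<Longrightarrow> snd e \<le> snd d" by blast
  show ?thesis
  proof (rule that[of e])
    show "fst r < fst q \<and> snd q < snd r" if "q \<in> S" "q \<notin> I" "r \<in> I" "snd q < snd e" for q r
      using se[of q r] that e(2)[of q] by force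
  qed (use e in auto)
qed

text \<open>The condition \<open>near\<close> covers two positions of \<open>e\<close>: it is
  automatic when \<open>e\<close> is to the right of \<open>I\<close>, and when \<open>e\<close> is
  to the left it says that no point of \<open>S\<close> lies horizontally between \<open>e\<close>
  and \<open>I\<close>.\<close>

lemma good_point_above:
  assumes e: "e \<in> S" "e \<notin> I" "\<And>q. q \<in> I \<Longrightarrow> snd q < snd e"
    and below: "\<And>q r. q \<in> S \<Longrightarrow> q \<notin> I \<Longrightarrow> r \<in> I \<Longrightarrow> snd q < snd e \<Longrightarrow> fst r < fst q \<and> snd q < snd r"
    and near: "\<And>q. q \<in> S \<Longrightarrow> fst e < fst q \<Longrightarrow> \<exists>r\<in>I. fst r \<le> fst q"
  shows "\<exists>p. good_point p"
proof -
  have "I \<noteq> {}" using I(3) by auto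
  then obtain a where a: "a \<in> I" "\<And>q. q \<in> I \<Longrightarrow> fst a \<le> fst q"
    using ex_min[OF finI, of fst] by blast
  obtain b where b: "b \<in> I" "b \<noteq> a" by (rule obtain_other[OF a(1)])
  have ab: "fst a < fst b" using a(2)[OF b(1)] fst_eqD[of a b] a b I_sub by force
  have aS: "a \<in> S" using a I_sub by auto
  obtain x where x: "fst a < x" "x \<notin> fst ` S" "\<And>t. t \<in> fst ` S \<Longrightarrow> fst a < t \<Longrightarrow> x < t"
    using just_above[of "fst ` S" "fst a"] finS by blast
  obtain y where y: "snd e < y" "y \<notin> snd ` S" "\<And>t. t \<in> snd ` S \<Longrightarrow> snd e < t \<Longrightarrow> y < t"
    using just_above[of "snd ` S" "snd e"] finS by blast
  define p where "p = (x, y)"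
  have pS: "p \<notin> S" using x(2) p_def by force
  have "x < fst b" using x(3)[of "fst b"] b ab I_sub by blast
  then have "cuts snd fst S I p"
    using cutsI[of a I b fst p e S snd] a(1) b x(1) e y(1) p_def by simp
  moreover have False if occ: "occurs (insert p S) \<pi> g" for g
  proof -
    obtain l where l: "l < length \<pi>" "g l = p" "\<And>i. i < length \<pi> \<Longrightarrow> i \<noteq> l \<Longrightarrow> g i \<in> S"
      using occurs_insertE[OF occ avoid pS] by blast
    have len: "3 < length \<pi>" using k by auto
    show False
    proof (cases "l = 0")
      case True
      \<comment> \<open>The point \<open>a\<close> is southwest of \<open>p\<close>, hence can
        replace it as the \<open>1\<close>.\<close>
      have "g i \<in> S \<and> fst a < fst (g i) \<and> snd a < snd (g i)" if i: "0 < i" "i < length \<pi>" for i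
        using occursD(2)[OF occ i] occursD(3)[OF occ i] l i True p_def x(1) y(1) e(3)[OF a(1)]
        by auto
      then show False using occurs_replace_first[OF occ aS] avoid by blast
    next
      case False
      have "g 0 \<in> S" by (rule l(3)) (use l(1) False in auto)
      then have g0: "g 0 \<in> S" "fst (g 0) < x" "snd (g 0) < y"
        using False occursD(2)[OF occ, of 0 l] occursD(3)[OF occ, of l] l p_def by auto
      have g0a: "fst (g 0) \<le> fst a" using x(3)[of "fst (g 0)"] g0 by force
      have g0e: "snd (g 0) \<le> snd e" using y(3)[of "snd (g 0)"] g0 by force
      \<comment> \<open>The \<open>1\<close> is no further right than \<open>a\<close> and no higher
        than \<open>e\<close>. Outside points lower than \<open>e\<close> are to the right of
        \<open>I\<close>, and \<open>a\<close> is the only point of \<open>I\<close> that far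
        left.\<close>
      have "g 0 = e \<or> g 0 = a"
      proof (rule ccontr)
        assume n: "\<not> ?thesis"
        then have "snd (g 0) < snd e" using g0e snd_eqD[of "g 0" e] g0 e by force
        then have "g 0 \<in> I" using below[of "g 0" a] g0 g0a a by force
        then show False using a(2)[of "g 0"] g0a fst_eqD[of "g 0" a] g0 aS n by force
      qed
      then show False
      proof
        assume ga: "g 0 = a"
        \<comment> \<open>No point of \<open>S\<close> lies horizontally between \<open>a\<close>
          and \<open>p\<close>, so \<open>p\<close> directly follows the \<open>1\<close> and plays
          \<open>z\<close>.\<close>
        have l1: "l = 1"
        proof (rule ccontr)
          assume "l \<noteq> 1"
          then have "1 < l" using False by simp
          then have "fst (g 1) < x" "g 1 \<in> S" "fst a < fst (g 1)"
            using occursD(2)[OF occ, of 1 l] occursD(2)[OF occ, of 0 1] l p_def ga by auto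
          then show False using x(3)[of "fst (g 1)"] by force
        qed
        let ?n = "last_index"
        have gn: "g ?n \<in> S" "snd a < snd (g ?n)" "snd (g ?n) < y"
          using l(3)[of ?n] l1 len occursD(3)[OF occ, of ?n] occursD(4)[OF occ, of 1] ga l(2) p_def
          by auto
        have gk: "g k \<in> S" "snd (g ?n) < snd (g k)" "snd (g k) < y"
          using l(3)[of k] l1 k occursD(4)[OF occ, of k] occursD(5)[OF occ] l(2) p_def by auto
        have gm: "g m \<in> S" "y < snd (g m)" "fst a < fst (g m)" "fst (g m) < fst (g ?n)"
          using l(3)[of m] l1 m occursD(2)[OF occ, of 0 m] occursD(2)[OF occ, of m ?n]
            occursD(6)[OF occ] l(2) p_def ga by auto
        \<comment> \<open>The entry between \<open>2\<close> and \<open>z\<close> is below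
          \<open>p\<close>, hence no higher than \<open>e\<close>. So the \<open>2\<close> is below
          \<open>e\<close> but above \<open>a\<close>, which forces it into \<open>I\<close>. The
          entry above \<open>z\<close> lies horizontally between \<open>a\<close> and the
          \<open>2\<close>, hence is also in \<open>I\<close>, although it is above
          \<open>e\<close>.\<close>
        have "snd (g k) \<le> snd e" using y(3)[of "snd (g k)"] gk by force
        then have "snd (g ?n) < snd e" using gk by simp
        then have nI: "g ?n \<in> I" using below[of "g ?n" a] gn a by force
        then have "g m \<in> I" using fst_side(2)[of "g m" a "g ?n"] gm a by force
        then show False using e(3)[of "g m"] gm y by force
      next
        assume ge: "g 0 = e"
        have ea: "fst e < fst a" using g0a ge fst_eqD[of e a] e aS a by force
        let ?n = "last_index"
        \<comment> \<open>No point of \<open>S\<close> lies vertically between \<open>e\<close> and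
          \<open>p\<close>, so \<open>p\<close> is the second lowest point and plays the final
          \<open>2\<close>.\<close>
        have ln: "l = ?n"
        proof (rule ccontr)
          assume "l \<noteq> ?n"
          then have "g ?n \<in> S" "snd (g ?n) < y" "snd e < snd (g ?n)"
            using l(3)[of ?n] len occursD(3)[OF occ, of ?n] occursD(4)[OF occ, of l] ge l(1,2)
              p_def False by auto
          then show False using y(3)[of "snd (g ?n)"] by force
        qed
        then have g1: "g 1 \<in> S" "fst e < fst (g 1)" "fst (g 1) < x" "snd e < snd (g 1)"
          using l(3)[of 1] len occursD(2)[OF occ, of 0 1] occursD(2)[OF occ, of 1 ?n]
            occursD(3)[OF occ, of 1] ge l(2) p_def by auto
        \<comment> \<open>The point playing \<open>z\<close> is right of \<open>e\<close> and left
          of \<open>p\<close>; by \<open>near\<close> it can only be \<open>a\<close>, which is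
          below \<open>e\<close>.\<close>
        have "fst (g 1) \<le> fst a" using x(3)[of "fst (g 1)"] g1 by force
        moreover obtain r where "r \<in> I" "fst r \<le> fst (g 1)" using near[OF g1(1,2)] by blast
        ultimately have "g 1 = a" using a(2)[of r] fst_eqD[of "g 1" a] g1 aS by force
        then show False using e(3)[OF a(1)] g1 by force
      qed
    qed
  qed
  ultimately have "good_point p" unfolding good_point_def using x y p_def by auto
  then show ?thesis ..
qed

lemma good_point_northwest:
  assumes sw: "\<And>c. c \<in> S \<Longrightarrow> c \<notin> I \<Longrightarrow> \<not> (\<forall>q\<in>I. fst c < fst q \<and> snd c < snd q)"
    and e: "e \<in> S" "e \<notin> I" "\<And>q. q \<in> I \<Longrightarrow> snd q < snd e"
    and below: "\<And>q r. q \<in> S \<Longrightarrow> q \<notin> I \<Longrightarrow> r \<in> I \<Longrightarrow> snd q < snd e \<Longrightarrow> fst r < fst q \<and> snd q < snd r"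
    and f0: "f0 \<in> S" "fst e < fst f0" "\<And>r. r \<in> I \<Longrightarrow> fst f0 < fst r"
  shows "\<exists>p. good_point p"
proof -
  let ?F = "{c \<in> S. \<forall>q\<in>I. fst c < fst q}"
  have "finite ?F" "f0 \<in> ?F" using finS f0 by simp_all
  then have "finite ?F" "?F \<noteq> {}" by blast+
  then have "\<exists>f\<in>?F. \<forall>d\<in>?F. fst d \<le> fst f" by (rule ex_max)
  then obtain f where "f \<in> ?F" and f_max: "\<And>d. d \<in> ?F \<Longrightarrow> fst d \<le> fst f" by blast
  then have f: "f \<in> S" "\<And>q. q \<in> I \<Longrightarrow> fst f < fst q" by auto
  have fI: "f \<notin> I" using f(2) by blast
  have ef: "fst e < fst f" using f_max[of f0] f0 by force
  obtain v where v: "v \<in> I" "\<And>q. q \<in> I \<Longrightarrow> q \<noteq> v \<Longrightarrow> snd q < snd v" using top_of_block by blast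
  obtain b where b: "b \<in> I" "b \<noteq> v" by (rule obtain_other[OF v(1)])
  have vS: "v \<in> S" using v I_sub by auto
  obtain x where x: "x < fst f" "x \<notin> fst ` S" "\<And>a. a \<in> fst ` S \<Longrightarrow> a < fst f \<Longrightarrow> a < x"
    using just_below[of "fst ` S" "fst f"] finS by blast
  obtain y where y: "y < snd v" "y \<notin> snd ` S" "\<And>a. a \<in> snd ` S \<Longrightarrow> a < snd v \<Longrightarrow> a < y"
    using just_below[of "snd ` S" "snd v"] finS by blast
  define p where "p = (x, y)"
  have pS: "p \<notin> S" using x(2) p_def by force
  have "snd b < y" using y(3)[of "snd b"] b v I_sub by blast
  then have "cuts fst snd S I p"
    using cutsI[of b I v snd p f S fst] b v y(1) f fI x(1) p_def by simp
  moreover have False if occ: "occurs (insert p S) \<pi> g" for g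
  proof -
    obtain l where l: "l < length \<pi>" "g l = p" "\<And>i. i < length \<pi> \<Longrightarrow> i \<noteq> l \<Longrightarrow> g i \<in> S"
      using occurs_insertE[OF occ avoid pS] by blast
    have len: "3 < length \<pi>" using k by auto
    let ?n = "last_index"
    show False
    proof (cases "l = 0")
      case True
      have ne: "g i \<in> S" "fst f \<le> fst (g i)" "snd v \<le> snd (g i)" if i: "0 < i" "i < length \<pi>" for i
      proof -
        show gi: "g i \<in> S" using l i True by auto
        have "x < fst (g i)" "y < snd (g i)"
          using occursD(2)[OF occ i] occursD(3)[OF occ i] l(2) True p_def by auto
        then show "fst f \<le> fst (g i)" "snd v \<le> snd (g i)"
          using x(3)[of "fst (g i)"] y(3)[of "snd (g i)"] gi by force+
      qed
      show False
      proof (cases "g ?n = v")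
        case nv: True
        \<comment> \<open>Points left of \<open>v\<close> and above it are outside \<open>I\<close>,
          hence left of all of \<open>I\<close>, and no such point is right of \<open>f\<close>. So
          \<open>f\<close> would play both \<open>z\<close> and the entry above it.\<close>
        have "g i = f" if i: "0 < i" "i < ?n" for i
        proof -
          have gi: "fst (g i) < fst v" "snd v < snd (g i)"
            using occursD(2)[OF occ, of i ?n] occursD(4)[OF occ, of i] nv i by auto
          then have "g i \<notin> I" using v(2)[of "g i"] by force
          then have "g i \<in> ?F" using fst_side(1)[of "g i" v] gi ne(1)[of i] i v(1) by force
          then have "fst (g i) = fst f" using f_max[of "g i"] ne(2)[of i] i by force
          then show ?thesis using fst_eqD[of "g i" f] ne(1)[of i] i f by force
        qed
        then have "g 1 = g m" using m by simp
        then show False using occursD(6)[OF occ] by simp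
      next
        case nv: False
        \<comment> \<open>The \<open>2\<close> is now strictly above \<open>v\<close>, hence so are
          all points other than \<open>p\<close>. They are therefore outside \<open>I\<close> and no
          lower than \<open>e\<close>; being at or right of \<open>f\<close>, they differ from
          \<open>e\<close>, which can replace \<open>p\<close>.\<close>
        have "g i \<in> S \<and> fst e < fst (g i) \<and> snd e < snd (g i)" if i: "0 < i" "i < length \<pi>" for i
        proof -
          note gi = ne[OF i]
          have "snd v < snd (g ?n)" using ne(3)[of ?n] ne(1)[of ?n] len nv snd_eqD[of v "g ?n"] vS
            by force
          moreover have "snd (g ?n) \<le> snd (g i)"
            using occursD(4)[OF occ, of i] i by (cases "i = ?n") force+
          ultimately have vi: "snd v < snd (g i)" by simp
          then have "g i \<notin> I" using v(2)[of "g i"] by force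
          then have "\<not> snd (g i) < snd e" using below[of "g i" v] gi v vi by force
          moreover have "g i \<noteq> e" using gi ef by force
          ultimately show ?thesis using snd_eqD[of "g i" e] gi e ef by force
        qed
        then show False using occurs_replace_first[OF occ e(1)] avoid by blast
      qed
    next
      case False
      have "g 0 \<in> S" by (rule l(3)) (use l(1) False in auto)
      then have g0: "g 0 \<in> S" "fst (g 0) < x" "snd (g 0) < y"
        using False occursD(2)[OF occ, of 0 l] occursD(3)[OF occ, of l] l p_def by auto
      \<comment> \<open>A \<open>1\<close> southwest of \<open>p\<close> would lie southwest of all
        of \<open>I\<close>, where there is no point.\<close>
      have left: "fst (g 0) < fst q" if "q \<in> I" for q using g0 x(1) f(2)[OF that] by simp
      then have "g 0 \<notin> I" by blast
      then show False using sw[of "g 0"] left snd_side(1)[of "g 0" v] g0 y(1) v(1) by force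
    qed
  qed
  ultimately have "good_point p" unfolding good_point_def using x y p_def by auto
  then show ?thesis ..
qed

lemma ex_good_point: "\<exists>p. good_point p"
proof (cases "\<exists>c\<in>S - I. \<forall>q\<in>I. fst c < fst q \<and> snd c < snd q")
  case True
  then show ?thesis using good_point_southwest by blast
next
  case False
  then have sw: "\<And>c. c \<in> S \<Longrightarrow> c \<notin> I \<Longrightarrow> \<not> (\<forall>q\<in>I. fst c < fst q \<and> snd c < snd q)" by blast
  obtain e where e: "e \<in> S" "e \<notin> I" "\<And>q. q \<in> I \<Longrightarrow> snd q < snd e"
    "\<And>q r. q \<in> S \<Longrightarrow> q \<notin> I \<Longrightarrow> r \<in> I \<Longrightarrow> snd q < snd e \<Longrightarrow> fst r < fst q \<and> snd q < snd r"
    using lowest_above[OF sw] by metis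
  show ?thesis
  proof (cases "\<exists>f\<in>S. fst e < fst f \<and> (\<forall>r\<in>I. fst f < fst r)")
    case True
    then show ?thesis using good_point_northwest[OF sw e] by blast
  next
    case False
    then have "\<exists>r\<in>I. fst r \<le> fst q" if "q \<in> S" "fst e < fst q" for q
      using that by (meson not_le_imp_less)
    then show ?thesis using good_point_above[OF e] by blast
  qed
qed

end

section \<open>Iterated extension to a set without nontrivial blocks\<close>

context pattern
begin

lemma extend_to_simple:
  assumes "generic S" "indecomposable S" "\<nexists>g. occurs S \<pi> g"
  shows "\<exists>T. S \<subseteq> T \<and> generic T \<and> (\<nexists>g. occurs T \<pi> g) \<and> nontrivial_blocks T = {}"
  using assms
proof (induction "card (nontrivial_blocks S)" arbitrary: S rule: less_induct)
  case (less S)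
  show ?case
  proof (cases "nontrivial_blocks S = {}")
    case True
    then show ?thesis using less.prems by blast
  next
    case False
    have fin: "finite (nontrivial_blocks S)"
      using finite_nontrivial_blocks genericD(1)[OF less.prems(1)] .
    obtain I where I: "I \<in> nontrivial_blocks S"
      and max: "\<And>K. K \<in> nontrivial_blocks S \<Longrightarrow> I \<subseteq> K \<Longrightarrow> I = K"
      using finite_has_maximal[OF fin False] by metis
    have Ib: "block S I" "I \<noteq> S" "2 \<le> card I" using I unfolding nontrivial_blocks_def by auto
    \<comment> \<open>The union of two overlapping blocks is a block, and it is proper because
      \<open>S\<close> is indecomposable; so the maximality of \<open>I\<close> absorbs
      \<open>K\<close>.\<close>
    have I_max: "K \<subseteq> I" if K: "block S K" "K \<noteq> S" "K \<inter> I \<noteq> {}" for K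
    proof -
      have u: "block S (K \<union> I)" using block_union K Ib by blast
      have "K \<union> I \<noteq> S" using less.prems(2) K Ib unfolding indecomposable_def by blast
      moreover have "2 \<le> card (K \<union> I)"
        using Ib(3) card_mono[of "K \<union> I" I] blockD(1)[OF u] genericD(1)[OF less.prems(1)]
        by (metis Un_upper2 finite_subset le_trans)
      ultimately have "K \<union> I \<in> nontrivial_blocks S" using u unfolding nontrivial_blocks_def by blast
      then show ?thesis using max[of "K \<union> I"] by blast
    qed
    interpret extension_step \<pi> k m S I
      using less.prems Ib by unfold_locales
    obtain p where p: "good_point p" using ex_good_point by blast
    interpret block_extension S I p
      by unfold_locales (use less.prems I_max p \<open>I \<in> nontrivial_blocks S\<close> in \<open>simp_all add: good_point_def\<close>)
    have "generic (insert p S)" using generic_insert[OF less.prems(1)] fresh by blast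
    then obtain T where "insert p S \<subseteq> T" "generic T" "\<nexists>g. occurs T \<pi> g" "nontrivial_blocks T = {}"
      using less.hyps[OF card_nontrivial_blocks_less _ indecomposable_insert] p
      unfolding good_point_def by blast
    then show ?thesis by blast
  qed
qed

end

section \<open>Translation between lists and point sets\<close>

lemma subseq_nth_embedding:
  assumes "subseq xs ys"
  shows "\<exists>f. \<forall>j<length xs. f j < length ys \<and> xs ! j = ys ! f j \<and> (\<forall>i<j. f i < f j)"
  using assms
proof (induction rule: list_emb.induct)
  case (list_emb_Cons xs ys y)
  then obtain f where "\<forall>j<length xs. f j < length ys \<and> xs ! j = ys ! f j \<and> (\<forall>i<j. f i < f j)"
    by blast
  then show ?case by (intro exI[of _ "\<lambda>j. Suc (f j)"]) simp
next
  case (list_emb_Cons2 x y xs ys)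
  then obtain f where f: "\<forall>j<length xs. f j < length ys \<and> xs ! j = ys ! f j \<and> (\<forall>i<j. f i < f j)"
    by blast
  \<comment> \<open>The common head is matched at index 0, and all later indices are shifted by
    one.\<close>
  show ?case
    using f list_emb_Cons2(1)
    by (intro exI[of _ "case_nat 0 (\<lambda>j. Suc (f j))"]) (auto split: nat.split simp: nth_Cons)
qed simp

text \<open>Lets an increasing choice of positions be read as a subsequence of the list of all
  positions; mapping both to entries gives a subsequence of the permutation.\<close>

lemma strict_sorted_subseq:
  fixes xs ys :: "'a::linorder list"
  assumes "sorted_wrt (<) xs" "sorted_wrt (<) ys" "set xs \<subseteq> set ys"
  shows "subseq xs ys"
  using assms
proof (induction ys arbitrary: xs)
  case (Cons y ys)
  show ?case
  proof (cases xs)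
    case (Cons x xs')
    show ?thesis
    proof (cases "x = y")
      case True
      then have "set xs' \<subseteq> set ys" using Cons.prems Cons by auto
      then show ?thesis using Cons.IH[of xs'] Cons.prems Cons True by auto
    next
      case False
      then have "set xs \<subseteq> set ys" using Cons.prems Cons by force
      then show ?thesis using Cons.IH[of xs] Cons.prems by auto
    qed
  qed simp
qed simp

lemma contained_in_iff:
  "contained_in \<alpha> \<beta> \<longleftrightarrow> (\<exists>f. (\<forall>j<length \<alpha>. f j < length \<beta> \<and> (\<forall>i<j. f i < f j)) \<and>
     (\<forall>i<length \<alpha>. \<forall>j<length \<alpha>. \<alpha> ! i < \<alpha> ! j \<longleftrightarrow> \<beta> ! f i < \<beta> ! f j))"
  (is "_ \<longleftrightarrow> (\<exists>f. ?P f)")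
proof
  assume "contained_in \<alpha> \<beta>"
  then obtain xs where xs: "subseq xs \<beta>" "same_order xs \<alpha>" unfolding contained_in_def by blast
  obtain f where "\<forall>j<length xs. f j < length \<beta> \<and> xs ! j = \<beta> ! f j \<and> (\<forall>i<j. f i < f j)"
    using subseq_nth_embedding[OF xs(1)] by blast
  moreover have "length xs = length \<alpha>"
    and "\<forall>i<length \<alpha>. \<forall>j<length \<alpha>. \<alpha> ! i < \<alpha> ! j \<longleftrightarrow> xs ! i < xs ! j"
    using xs(2) unfolding same_order_def by auto
  ultimately have "?P f" by simp
  then show "\<exists>f. ?P f" by (rule exI[of ?P])
next
  assume "\<exists>f. ?P f"
  then obtain f where f: "?P f" by blast
  let ?is = "map f [0..<length \<alpha>]"
  have "subseq ?is [0..<length \<beta>]"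
    by (rule strict_sorted_subseq) (use f in \<open>auto simp: sorted_wrt_iff_nth_less\<close>)
  then have "subseq (map ((!) \<beta>) ?is) \<beta>"
    using subseq_map[of ?is "[0..<length \<beta>]" "(!) \<beta>"] by (simp add: map_nth)
  moreover have "same_order (map ((!) \<beta>) ?is) \<alpha>"
    unfolding same_order_def using f by simp
  ultimately show "contained_in \<alpha> \<beta>" unfolding contained_in_def by blast
qed

text \<open>Only the relative order of the coordinates is tied to \<open>\<beta>\<close>, so the
  same notion serves for a permutation drawn on the integer grid and for the point set that the
  extension produces.\<close>

definition realizes :: "(real \<times> real) list \<Rightarrow> nat list \<Rightarrow> bool" where
  "realizes ps \<beta> \<longleftrightarrow> length ps = length \<beta> \<and> sorted_wrt (\<lambda>p q. fst p < fst q) ps \<and>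
     (\<forall>i<length \<beta>. \<forall>j<length \<beta>. \<beta> ! i < \<beta> ! j \<longleftrightarrow> snd (ps ! i) < snd (ps ! j))"

lemma realizes_fst_less:
  assumes "realizes ps \<beta>" "i < length \<beta>" "j < length \<beta>"
  shows "fst (ps ! i) < fst (ps ! j) \<longleftrightarrow> i < j"
proof -
  have "sorted_wrt (\<lambda>p q. fst p < fst q) ps" "length ps = length \<beta>"
    using assms(1) unfolding realizes_def by auto
  then have "\<And>i j. i < j \<Longrightarrow> j < length \<beta> \<Longrightarrow> fst (ps ! i) < fst (ps ! j)"
    by (simp add: sorted_wrt_iff_nth_less)
  then show ?thesis using assms(2,3) by (metis less_asym less_irrefl nat_neq_iff)
qed

lemma realizes_distinct: "realizes ps \<beta> \<Longrightarrow> distinct ps"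
  unfolding realizes_def sorted_wrt_iff_nth_less distinct_conv_nth
  by (metis less_irrefl nat_neq_iff)

lemma contained_in_realized:
  assumes "realizes ps \<beta>"
  shows "contained_in \<alpha> \<beta> \<longleftrightarrow> (\<exists>g. occurs (set ps) \<alpha> g)"
proof
  have len: "length ps = length \<beta>"
    and ord: "\<And>i j. i < length \<beta> \<Longrightarrow> j < length \<beta> \<Longrightarrow> \<beta> ! i < \<beta> ! j \<longleftrightarrow> snd (ps ! i) < snd (ps ! j)"
    using assms unfolding realizes_def by auto
  {
    assume "contained_in \<alpha> \<beta>"
    then obtain f where f: "\<And>j. j < length \<alpha> \<Longrightarrow> f j < length \<beta>"
        "\<And>i j. j < length \<alpha> \<Longrightarrow> i < j \<Longrightarrow> f i < f j"
        "\<And>i j. i < length \<alpha> \<Longrightarrow> j < length \<alpha> \<Longrightarrow> \<alpha> ! i < \<alpha> ! j \<longleftrightarrow> \<beta> ! f i < \<beta> ! f j"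
      unfolding contained_in_iff by blast
    have "occurs (set ps) \<alpha> (\<lambda>i. ps ! f i)"
      unfolding occurs_def using f ord len realizes_fst_less[OF assms] by simp
    then show "\<exists>g. occurs (set ps) \<alpha> g" by blast
  }
  assume "\<exists>g. occurs (set ps) \<alpha> g"
  then obtain g where g: "occurs (set ps) \<alpha> g" by blast
  have "\<forall>i. \<exists>l. i < length \<alpha> \<longrightarrow> l < length \<beta> \<and> ps ! l = g i"
    using g len unfolding occurs_def by (metis in_set_conv_nth)
  then obtain f where f: "\<And>i. i < length \<alpha> \<Longrightarrow> f i < length \<beta> \<and> ps ! f i = g i" by metis
  have "f i < f j" if "j < length \<alpha>" "i < j" for i j
    using realizes_fst_less[OF assms, of "f i" "f j"] f[of i] f[of j] that g
    unfolding occurs_def by simp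
  moreover have "\<alpha> ! i < \<alpha> ! j \<longleftrightarrow> \<beta> ! f i < \<beta> ! f j" if "i < length \<alpha>" "j < length \<alpha>" for i j
    using ord f that g unfolding occurs_def by simp
  ultimately show "contained_in \<alpha> \<beta>" unfolding contained_in_iff using f by blast
qed

lemma ex_realized_perm:
  assumes "generic T" "T \<noteq> {}"
  obtains ps \<tau> where "set ps = T" "realizes ps \<tau>" "perm \<tau>"
proof -
  note fin = genericD(1)[OF assms(1)]
  obtain xs where xs: "set xs = T" "distinct xs" using finite_distinct_list[OF fin] by blast
  define ps where "ps = sort_key fst xs"
  have ps: "set ps = T" "distinct ps" "length ps = card T"
    using xs distinct_card[of xs] by (auto simp: ps_def)
  have "distinct (map fst ps)"
    using ps assms(1) by (simp add: distinct_map generic_def)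
  then have sorted: "sorted_wrt (\<lambda>p q. fst p < fst q) ps"
    using sorted_sort_key[of fst xs] strict_sorted_iff[of "map fst ps"]
    by (simp add: ps_def sorted_wrt_map)
  \<comment> \<open>The rank of \<open>p\<close> by height; the count includes \<open>p\<close>
    itself, so ranks run from 1 to \<open>card T\<close>, as \<open>perm\<close> requires.\<close>
  define r where "r p = card {q \<in> T. snd q \<le> snd p}" for p :: "real \<times> real"
  have r_less: "r p < r q \<longleftrightarrow> snd p < snd q" if "p \<in> T" "q \<in> T" for p q
  proof
    assume "snd p < snd q"
    then have "{t \<in> T. snd t \<le> snd p} \<subset> {t \<in> T. snd t \<le> snd q}" using that by force
    then show "r p < r q" unfolding r_def using fin by (simp add: psubset_card_mono)
  next
    assume "r p < r q"
    then show "snd p < snd q" unfolding r_def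
      using fin card_mono[of "{t \<in> T. snd t \<le> snd p}" "{t \<in> T. snd t \<le> snd q}"]
      by (force simp: not_less[symmetric])
  qed
  have inj: "inj_on r T"
    using r_less genericD(3)[OF assms(1)] by (intro inj_onI) (metis less_irrefl linorder_neqE)
  have "r ` T \<subseteq> {1..card T}"
  proof
    fix z assume "z \<in> r ` T"
    then obtain p where p: "p \<in> T" "z = r p" by blast
    then have "{q \<in> T. snd q \<le> snd p} \<noteq> {}" by blast
    then have "r p > 0" unfolding r_def using fin by (simp add: card_gt_0_iff)
    moreover have "r p \<le> card T" unfolding r_def using fin by (simp add: card_mono)
    ultimately show "z \<in> {1..card T}" using p by simp
  qed
  then have "r ` T = {1..card T}"
    by (intro card_subset_eq) (simp_all add: card_image[OF inj])
  then have "perm (map r ps)"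
    unfolding perm_def using ps assms(2) inj by (auto simp: distinct_map)
  moreover have "realizes ps (map r ps)"
    unfolding realizes_def using sorted ps r_less by (metis length_map nth_map nth_mem)
  ultimately show ?thesis using that ps by blast
qed

text \<open>An interval yields a proper block of the same cardinality: consecutive positions give
  convexity in \<open>fst\<close>, consecutive values convexity in \<open>snd\<close>. Without
  nontrivial blocks this cardinality is 1.\<close>

lemma simple_perm_realized:
  assumes T: "nontrivial_blocks (set ps) = {}" and real: "realizes ps \<tau>" and "perm \<tau>"
  shows "simple_perm \<tau>"
  unfolding simple_perm_def
proof (intro conjI allI impI)
  fix S assume "interval_of \<tau> S"
  then obtain a b i j where S: "S \<noteq> {}" "S \<subset> set \<tau>" "S = {a..b}"
      and pos: "{l. l < length \<tau> \<and> \<tau> ! l \<in> S} = {i..j}"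
    unfolding interval_of_def by blast
  have len: "length ps = length \<tau>"
    and ord: "\<And>i j. i < length \<tau> \<Longrightarrow> j < length \<tau> \<Longrightarrow> \<tau> ! i < \<tau> ! j \<longleftrightarrow> snd (ps ! i) < snd (ps ! j)"
    using real unfolding realizes_def by auto
  define P where "P = {i..j}"
  have posI: "\<And>l. l \<in> P \<longleftrightarrow> l < length \<tau> \<and> \<tau> ! l \<in> S" using pos unfolding P_def by blast
  let ?K = "(!) ps ` P"
  have "S = (!) \<tau> ` P"
  proof
    show "S \<subseteq> (!) \<tau> ` P"
    proof
      fix v assume v: "v \<in> S"
      then obtain l where "l < length \<tau>" "\<tau> ! l = v" using S(2) by (metis in_set_conv_nth psubsetE subsetD)
      then show "v \<in> (!) \<tau> ` P" using posI v by blast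
    qed
  qed (use posI in blast)
  moreover have "inj_on ((!) \<tau>) P"
    by (rule inj_on_nth) (use \<open>perm \<tau>\<close> posI perm_def in blast)+
  moreover have "inj_on ((!) ps) P"
    by (rule inj_on_nth[OF realizes_distinct[OF real]]) (use posI len in simp)
  ultimately have card_S: "card S = card ?K" by (metis card_image)
  have "block (set ps) ?K"
    unfolding block_def convex_in_def
  proof (intro conjI ballI impI)
    show "?K \<subseteq> set ps" using posI len by (metis image_subsetI nth_mem)
    fix p q r assume pqr: "p \<in> set ps - ?K" "q \<in> ?K" "r \<in> ?K"
    obtain x where x: "x < length \<tau>" "p = ps ! x"
      using pqr(1) len in_set_conv_nth[of p ps] by auto
    have x': "x \<notin> P" using pqr(1) x(2) by blast
    obtain y where y: "y \<in> P" "q = ps ! y" using pqr(2) by blast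
    obtain z where z: "z \<in> P" "r = ps ! z" using pqr(3) by blast
    have l: "y < length \<tau>" "z < length \<tau>" "\<tau> ! y \<in> {a..b}" "\<tau> ! z \<in> {a..b}" "\<tau> ! x \<notin> {a..b}"
      using posI x(1) x' y(1) z(1) S(3) by blast+
    show "fst r < fst p" if "fst q < fst p"
      using that x x' y z l realizes_fst_less[OF real] by (auto simp: P_def)
    show "snd r < snd p" if "snd q < snd p"
      using that x y z l ord[of y x] ord[of z x] by auto
  qed
  moreover have "?K \<noteq> set ps"
  proof
    assume K: "?K = set ps"
    obtain v where "v \<in> set \<tau>" "v \<notin> S" using S(2) by blast
    then obtain l where l: "l < length \<tau>" "\<tau> ! l \<notin> S" by (metis in_set_conv_nth)
    then have "ps ! l \<in> ?K" using K len by simp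
    then obtain l' where l': "l' \<in> P" "ps ! l = ps ! l'" by blast
    then have "l = l'" using realizes_distinct[OF real] l posI len by (simp add: nth_eq_iff_index_eq)
    then show False using l l' posI by blast
  qed
  ultimately have "card S < 2" using T card_S unfolding nontrivial_blocks_def by force
  moreover have "0 < card S" using S by (metis card_gt_0_iff finite_atLeastAtMost)
  ultimately have "card S = 1" by simp
  then show "is_singleton S" by (simp add: is_singleton_altdef)
qed (rule assms(3))

section \<open>The frame around a permutation\<close>

text \<open>
  \<open>frame\<close> is the inflation of \<open>2413\<close> by \<open>\<sigma>\<close> at its entry \<open>1\<close>.
\<close>

locale framed =
  fixes \<sigma> :: "nat list"
  assumes perm: "perm \<sigma>"
begin

abbreviation "n \<equiv> real (length \<sigma>)"

text \<open>As \<open>B\<close> has abscissas from 0 to \<open>n - 1\<close> and heights from 1 to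
  \<open>n\<close>, these coordinates put \<open>u\<close> and \<open>w1\<close> to its left,
  \<open>w2\<close> to its right and all three above it.\<close>

definition "u = (- 2 :: real, n + 1)"
definition "w1 = (- 1 :: real, n + 3)"
definition "w2 = (n, n + 2)"
definition "B = (\<lambda>i. (real i, real (\<sigma> ! i))) ` {..<length \<sigma>}"
definition "frame = insert u (insert w1 (insert w2 B))"

lemma B_bounds:
  assumes "b \<in> B"
  shows "0 \<le> fst b" "fst b < n" "0 < snd b" "snd b \<le> n"
proof -
  obtain i where i: "i < length \<sigma>" "b = (real i, real (\<sigma> ! i))" using assms unfolding B_def by blast
  have "\<sigma> ! i \<in> {1..length \<sigma>}" using perm i nth_mem unfolding perm_def by blast
  then show "0 \<le> fst b" "fst b < n" "0 < snd b" "snd b \<le> n" using i by auto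
qed

lemma B_nonempty: "B \<noteq> {}"
  using perm unfolding perm_def B_def by auto

lemma frame_cases:
  assumes "p \<in> frame"
  obtains "p = u" | "p = w1" | "p = w2" | "p \<in> B"
  using assms unfolding frame_def by blast

lemma realizes_points: "realizes (map (\<lambda>i. (real i, real (\<sigma> ! i))) [0..<length \<sigma>]) \<sigma>"
  unfolding realizes_def by (simp add: sorted_wrt_iff_nth_less)

lemma contained_in_iff_occurs: "contained_in \<alpha> \<sigma> \<longleftrightarrow> (\<exists>g. occurs B \<alpha> g)"
  using contained_in_realized[OF realizes_points] by (simp add: B_def atLeast0LessThan)

lemma generic_frame: "generic frame"
proof -
  have "inj_on fst B" "inj_on snd B"
    using perm unfolding B_def perm_def
    by (auto simp: inj_on_def nth_eq_iff_index_eq)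
  then have B: "generic B" unfolding generic_def B_def by simp
  show ?thesis
    unfolding frame_def
    by (intro generic_insert B) (use B_bounds in \<open>force simp: u_def w1_def w2_def\<close>)+
qed

text \<open>Of two proper blocks covering \<open>frame\<close>, let \<open>K\<close> contain
  \<open>u\<close>. It omits \<open>w2\<close>, since \<open>u\<close> and \<open>w2\<close> are
  leftmost and rightmost, and so omits \<open>w1\<close>, since \<open>w2\<close> is vertically
  between \<open>u\<close> and \<open>w1\<close>. The other block then contains \<open>w1\<close>
  and \<open>w2\<close>, hence everything right of \<open>u\<close>, hence also \<open>u\<close>,
  which is vertically between \<open>B\<close> and \<open>w1\<close>.\<close>

lemma indecomposable_frame: "indecomposable (frame)"
proof -
  let ?S = "frame"
  have key: False if K: "block ?S K" "K \<noteq> ?S" and L: "block ?S L" "L \<noteq> ?S"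
    and un: "K \<union> L = ?S" and u: "u \<in> K" for K L
  proof -
    have mem: "u \<in> ?S" "w1 \<in> ?S" "w2 \<in> ?S" "B \<subseteq> ?S" unfolding frame_def by auto
    obtain b where b: "b \<in> B" using B_nonempty by blast
    have n: "0 \<le> n" by simp
    have u_le: "fst u < fst p" if "p \<in> ?S" "p \<noteq> u" for p
      using that(1) by (cases rule: frame_cases)
        (use that n B_bounds[of p] in \<open>auto simp: u_def w1_def w2_def\<close>)
    have w1_le: "fst w1 < fst p" if "p \<in> ?S" "p \<noteq> u" "p \<noteq> w1" for p
      using that(1) by (cases rule: frame_cases)
        (use that n B_bounds[of p] in \<open>auto simp: u_def w1_def w2_def\<close>)
    have le_w2: "fst p \<le> fst w2" if "p \<in> ?S" for p
      using that by (cases rule: frame_cases)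
        (use that n B_bounds[of p] in \<open>auto simp: u_def w1_def w2_def\<close>)
    have "w2 \<notin> K"
    proof
      assume w: "w2 \<in> K"
      have "p \<in> K" if "p \<in> ?S" for p
      proof (rule ccontr)
        assume "p \<notin> K"
        then have "fst w2 < fst p"
          using convex_inD[OF blockD(2)[OF K(1)] that _ u w] u_le[OF that] u by blast
        then show False using le_w2[OF that] by simp
      qed
      then show False using K blockD(1) by blast
    qed
    then have w2: "w2 \<in> L" using un mem by blast
    have "w1 \<notin> K"
      using convex_inD[OF blockD(3)[OF K(1)] mem(3) \<open>w2 \<notin> K\<close> u, of w1]
      by (auto simp: u_def w1_def w2_def)
    then have w1: "w1 \<in> L" using un mem by blast
    have L_mem: "p \<in> L" if "p \<in> ?S" "p \<noteq> u" for p
    proof (rule ccontr)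
      assume p: "p \<notin> L"
      then have "fst w2 < fst p"
        using convex_inD[OF blockD(2)[OF L(1)] that(1) p w1 w2] w1_le[OF that] w1 by blast
      then show False using le_w2[OF that(1)] by simp
    qed
    have "b \<noteq> u" using B_bounds[OF b] by (auto simp: u_def)
    then have bL: "b \<in> L" using L_mem b mem by blast
    have "u \<notin> L" using L L_mem blockD(1)[OF L(1)] by blast
    then have "snd w1 < snd u"
      using convex_inD[OF blockD(3)[OF L(1)] mem(1) _ bL w1] B_bounds[OF b] by (simp add: u_def)
    then show False by (simp add: u_def w1_def)
  qed
  have "u \<in> ?S" unfolding frame_def by simp
  then show ?thesis
    unfolding indecomposable_def using key by (metis Un_commute UnE)
qed

end

context pattern
begin

lemma ex_simple_extension:
  assumes "perm \<sigma>" "\<not> contained_in \<pi> \<sigma>"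
  shows "\<exists>\<tau>. simple_perm \<tau> \<and> \<not> contained_in \<pi> \<tau> \<and> contained_in \<sigma> \<tau>"
proof -
  interpret framed \<sigma> by unfold_locales (fact assms(1))
  \<comment> \<open>The cases concern the point playing the \<open>1\<close>. Above \<open>u\<close>
    there are only two points, but three further entries of distinct heights are needed; nothing is
    above \<open>w1\<close> or right of \<open>w2\<close>. If the \<open>1\<close> is in
    \<open>B\<close>, the only other point available outside \<open>B\<close> is \<open>w2\<close>;
    being rightmost it would have to play the final \<open>2\<close>, yet nothing available is above
    it. So the occurrence would lie in \<open>B\<close>.\<close>
  have "\<nexists>g. occurs frame \<pi> g"
  proof
    assume "\<exists>g. occurs frame \<pi> g"
    then obtain g where g: "occurs frame \<pi> g" by blast
    have len: "3 < length \<pi>" using k by simp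
    have up: "p = u \<or> p = w1 \<or> p = w2" if "p \<in> frame" "n < snd p" for p
      using that(1) by (cases rule: frame_cases) (use that(2) B_bounds[of p] in auto)
    from occursD(1)[OF g, of 0] len have "g 0 \<in> frame" by force
    then show False
    proof (cases rule: frame_cases)
      case 1
      have "g i = w1 \<or> g i = w2" if i: "0 < i" "i < length \<pi>" for i
        using up[OF occursD(1)[OF g i(2)]] occursD(3)[OF g i] 1 by (auto simp: u_def)
      then have "g 1 \<in> {w1, w2}" "g k \<in> {w1, w2}" "g m \<in> {w1, w2}" using k m len by simp_all
      then show False using occursD(5,6)[OF g] by auto
    next
      case 2
      have "snd w1 < snd (g 1)" "g 1 \<in> frame"
        using occursD(3)[OF g, of 1] occursD(1)[OF g, of 1] len 2 by auto
      then show False using up[of "g 1"] by (auto simp: u_def w1_def w2_def)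
    next
      case 3
      have "fst w2 < fst (g 1)" "g 1 \<in> frame"
        using occursD(2)[OF g, of 0 1] occursD(1)[OF g, of 1] len 3 by auto
      from this(2,1) show False
        by (cases rule: frame_cases) (use B_bounds[of "g 1"] in \<open>auto simp: u_def w1_def w2_def\<close>)
    next
      case 4
      have right: "g i = w2 \<or> g i \<in> B" if i: "0 < i" "i < length \<pi>" for i
      proof -
        have "0 < fst (g i)" using occursD(2)[OF g i] B_bounds[OF 4] by simp
        with occursD(1)[OF g i(2)] show ?thesis
          by (cases rule: frame_cases) (auto simp: u_def w1_def)
      qed
      have "g i \<in> B" if i: "i < length \<pi>" for i
      proof (rule ccontr)
        assume n: "g i \<notin> B"
        then have i0: "0 < i" using 4 by (cases i) auto
        then have w: "g i = w2" using right[OF i0 i] n by blast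
        show False
        proof (cases "i = last_index")
          case True
          have "snd w2 < snd (g 1)" using occursD(4)[OF g, of 1] w True len by simp
          then show False using right[of 1] len B_bounds[of "g 1"] by (auto simp: w2_def)
        next
          case False
          then have "fst w2 < fst (g last_index)"
            using occursD(2)[OF g, of i last_index] w i by simp
          moreover have "0 < last_index" "last_index < length \<pi>" using len by auto
          ultimately show False using right[of last_index] B_bounds(2)[of "g last_index"]
            by (auto simp: w2_def)
        qed
      qed
      then have "occurs B \<pi> g" using g unfolding occurs_def by blast
      then show False using assms(2) contained_in_iff_occurs by blast
    qed
  qed
  then obtain T where T: "frame \<subseteq> T" "generic T" "\<nexists>g. occurs T \<pi> g" "nontrivial_blocks T = {}"
    using extend_to_simple[OF generic_frame indecomposable_frame] by blast
  then have "T \<noteq> {}" unfolding frame_def by blast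
  then obtain ps \<tau> where \<tau>: "set ps = T" "realizes ps \<tau>" "perm \<tau>"
    using ex_realized_perm[OF T(2)] by metis
  have "contained_in \<sigma> \<sigma>"
    unfolding contained_in_def same_order_def by blast
  then obtain g where "occurs B \<sigma> g" using contained_in_iff_occurs by blast
  then have "occurs T \<sigma> g" using T(1) unfolding occurs_def frame_def by blast
  then have "contained_in \<sigma> \<tau>" using contained_in_realized[OF \<tau>(2)] \<tau>(1) by blast
  moreover have "\<not> contained_in \<pi> \<tau>" using contained_in_realized[OF \<tau>(2)] \<tau>(1) T(3) by blast
  moreover have "simple_perm \<tau>" using simple_perm_realized[OF _ \<tau>(2,3)] \<tau>(1) T(4) by blast
  ultimately show ?thesis by blast
qed

end

section \<open>Non-deflatability\<close>

text \<open>A class and its substitution closure have the same simple permutations. So a simple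
  \<open>\<tau>\<close> in \<open>C\<close> that contains a member of \<open>C\<close> outside
  \<open>D\<close> would itself lie in \<open>D\<close>, and closure under containment would put
  that member into \<open>D\<close>.\<close>

lemma not_deflatableI:
  assumes "\<And>\<sigma>. \<sigma> \<in> C \<Longrightarrow> \<exists>\<tau>\<in>C. simple_perm \<tau> \<and> contained_in \<sigma> \<tau>"
    and "\<And>\<sigma>. \<sigma> \<in> C \<Longrightarrow> perm \<sigma>"
  shows "\<not> deflatable C"
proof
  assume "deflatable C"
  then obtain D where D: "perm_class D" "D \<subset> C" "C \<subseteq> subst_closure D"
    unfolding deflatable_def by blast
  then obtain \<sigma> where \<sigma>: "\<sigma> \<in> C" "\<sigma> \<notin> D" by blast
  obtain \<tau> where \<tau>: "\<tau> \<in> C" "simple_perm \<tau>" "contained_in \<sigma> \<tau>" using assms(1)[OF \<sigma>(1)] by blast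
  obtain E where "simples E = simples D" "\<tau> \<in> E"
    using \<tau>(1) D(3) subst_closure_eq_Union[OF D(1)] by blast
  then have "\<tau> \<in> D" using \<tau>(2) unfolding simples_def by blast
  then show False using D(1) \<tau>(3) \<sigma> assms(2) unfolding perm_class_def by blast
qed

theorem theorem3p8:
  fixes \<rho> :: "nat list"
  assumes "perm \<rho>"
    and "last \<rho> = Min (set \<rho>)"
    and "hd \<rho> \<noteq> 2"
    and "hd \<rho> \<noteq> length \<rho>"
  shows "\<not> deflatable (Av (one_oplus \<rho>))"
proof -
  let ?N = "length \<rho>" and ?\<pi> = "one_oplus \<rho>"
  have \<rho>: "\<rho> \<noteq> []" "distinct \<rho>" "set \<rho> = {1..?N}" using assms(1) unfolding perm_def by auto
  have N: "0 < ?N" using \<rho>(1) by simp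
  have last1: "\<rho> ! (?N - 1) = 1"
  proof -
    have "Min {1..?N} = 1" by (rule Min_eqI) (use \<rho>(1) in \<open>auto simp: Suc_le_eq\<close>)
    then show ?thesis using assms(2) \<rho> last_conv_nth[of \<rho>] by metis
  qed
  have hd0: "hd \<rho> = \<rho> ! 0" using \<rho>(1) by (rule hd_conv_nth)
  have mem: "\<rho> ! i \<in> {1..?N}" if "i < ?N" for i using \<rho>(3) that nth_mem by blast
  have ge2: "2 \<le> \<rho> ! i" if "i < ?N - 1" for i
  proof -
    have "\<rho> ! i \<noteq> \<rho> ! (?N - 1)" using that \<rho>(2) by (simp add: nth_eq_iff_index_eq)
    moreover have "i < ?N" using that by simp
    ultimately show ?thesis using mem[of i] last1 by simp
  qed
  \<comment> \<open>In length 1 the first entry would equal the length, which is excluded.\<close>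
  have "?N \<noteq> 1" using last1 assms(4) hd0 by auto
  then have hd: "2 < \<rho> ! 0" "\<rho> ! 0 < ?N" using ge2[of 0] mem[of 0] N assms(3,4) hd0 by auto
  \<comment> \<open>Prefixing the new minimum raises all values by one: the \<open>2\<close> of
    \<open>\<rho>\<close> becomes a \<open>3\<close>, strictly between \<open>2\<close> and
    \<open>z\<close>, and the maximum of \<open>\<rho>\<close> becomes an entry above
    \<open>z\<close>. Their indices are the parameters \<open>k\<close> and \<open>m\<close> of
    \<open>pattern\<close>.\<close>
  have "2 \<in> set \<rho>" "?N \<in> set \<rho>" using \<rho>(3) hd by auto
  then obtain i j where i: "i < ?N" "\<rho> ! i = 2" and j: "j < ?N" "\<rho> ! j = ?N"
    by (metis in_set_conv_nth)
  have "i \<noteq> 0" "i \<noteq> ?N - 1" "j \<noteq> 0" "j \<noteq> ?N - 1"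
    using i j hd last1 by (cases "i = 0"; cases "j = 0"; auto)+
  moreover have len: "length ?\<pi> = Suc ?N" and Suc_nth: "\<And>l. l < ?N \<Longrightarrow> ?\<pi> ! Suc l = Suc (\<rho> ! l)"
    and zero: "?\<pi> ! 0 = 1"
    unfolding one_oplus_def by simp_all
  ultimately interpret pattern ?\<pi> "Suc i" "Suc j"
  proof (unfold_locales, goal_cases)
    case (1 l)
    then show ?case using len Suc_nth[of "l - 1"] mem[of "l - 1"] zero by (cases l) auto
  next
    case (2 l)
    have "?\<pi> ! ?N = 2" using Suc_nth[of "?N - 1"] last1 N by simp
    with 2 show ?case using len Suc_nth[of "l - 1"] ge2[of "l - 1"]
      by (cases l) (auto simp: less_diff_conv Suc_le_eq numeral_2_eq_2)
  qed (use len Suc_nth[of 0] Suc_nth[of i] Suc_nth[of j] i j hd N in auto)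
  show ?thesis
    by (rule not_deflatableI)
      (use ex_simple_extension in \<open>auto simp: Av_def simple_perm_def\<close>)
qed

end
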